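(* Let $\Phi=\{\varphi_i\}_{i=1}^M$ be a finite family of vectors in a vector space $V$ and let $k\ge 1$ be an integer. If $\Phi$ cannot be partitioned into $k$ linearly independent sets, then there exist a partition $\{A_i\}_{i=1}^k$ of $\Phi$ and a subspace $S$ of $V$ such that: (i) for all $1\le i\le k$, there exists a subset $S_i\subseteq A_i$ such that $S=\operatorname{span}(S_i)$; (ii) for $J=\{\varphi\in\Phi:\varphi\in S\}$, $|J|/\dim\operatorname{span}(J)>k$.
   Context: $\Phi=\{\varphi_i\}_{i=1}^M$ is a finite indexed family (repetitions allowed); subsets, cardinalities and partitions of $\Phi$ are understood in terms of the index set $\{1,\dots,M\}$, so a subfamily with a repeated vector is linearly dependent; in particular $J$ corresponds to $\{i:\varphi_i\in S\}$. Sets of a partition are allowed to be empty. The inequality $|J|/\dim\operatorname{span}(J)>k$ is understood as $|J|>k\,\dim\operatorname{span}(J)$ (which settles its meaning when $\dim\operatorname{span}(J)=0$). *)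

theory Defs
  imports Complex_Main "HOL-Library.Disjoint_Sets"
begin

text \<open>Linear independence of the subfamily indexed by \<open>A\<close>: a repeated vector makes it dependent.\<close>

definition independent_family ::
    "('a::field \<Rightarrow> 'b::ab_group_add \<Rightarrow> 'b) \<Rightarrow> ('i \<Rightarrow> 'b) \<Rightarrow> 'i set \<Rightarrow> bool" where
  "independent_family scale \<phi> A \<longleftrightarrow> inj_on \<phi> A \<and> \<not> module.dependent scale (\<phi> ` A)"

lemma (in vector_space) independent_family_iff_coefficients:
  assumes "finite A"
  shows "independent_family scale \<phi> A \<longleftrightarrow>
    (\<forall>c. (\<Sum>i\<in>A. scale (c i) (\<phi> i)) = 0 \<longrightarrow> (\<forall>i\<in>A. c i = 0))"
proof
  assume ind: "independent_family scale \<phi> A"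
  then have inj: "inj_on \<phi> A" by (simp add: independent_family_def)
  show "\<forall>c. (\<Sum>i\<in>A. scale (c i) (\<phi> i)) = 0 \<longrightarrow> (\<forall>i\<in>A. c i = 0)"
  proof (intro allI impI ballI)
    fix c i
    assume s: "(\<Sum>i\<in>A. scale (c i) (\<phi> i)) = 0" and i: "i \<in> A"
    have "(\<Sum>v\<in>\<phi> ` A. scale (c (the_inv_into A \<phi> v)) v) = (\<Sum>i\<in>A. scale (c i) (\<phi> i))"
      by (simp add: sum.reindex[OF inj] the_inv_into_f_f[OF inj])
    with s have "\<forall>v\<in>\<phi> ` A. c (the_inv_into A \<phi> v) = 0"
      using ind assms independent_family_def dependent_finite[of "\<phi> ` A"] by fastforce
    with i show "c i = 0" by (simp add: the_inv_into_f_f[OF inj])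
  qed
next
  assume coeff: "\<forall>c. (\<Sum>i\<in>A. scale (c i) (\<phi> i)) = 0 \<longrightarrow> (\<forall>i\<in>A. c i = 0)"
  have inj: "inj_on \<phi> A"
  proof (rule inj_onI, rule ccontr)
    fix i j assume ij: "i \<in> A" "j \<in> A" "\<phi> i = \<phi> j" "i \<noteq> j"
    define c where "c l = (if l = i then 1 else if l = j then - 1 else 0 :: 'a)" for l
    have "(\<Sum>l\<in>A. scale (c l) (\<phi> l)) = (\<Sum>l\<in>{i, j}. scale (c l) (\<phi> l))"
      by (rule sum.mono_neutral_right) (use assms ij in \<open>auto simp: c_def\<close>)
    also have "\<dots> = 0" using ij by (simp add: c_def)
    finally have "c i = 0" using coeff ij by blast
    then show False by (simp add: c_def)
  qed
  moreover have "\<not> dependent (\<phi> ` A)"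
  proof
    assume "dependent (\<phi> ` A)"
    then obtain u where u: "\<exists>v\<in>\<phi> ` A. u v \<noteq> 0" "(\<Sum>v\<in>\<phi> ` A. scale (u v) v) = 0"
      using assms by (auto simp: dependent_finite)
    then have "(\<Sum>i\<in>A. scale (u (\<phi> i)) (\<phi> i)) = 0" by (simp add: sum.reindex[OF inj])
    then have "\<forall>i\<in>A. u (\<phi> i) = 0" using spec[OF coeff, of "\<lambda>i. u (\<phi> i)"] by blast
    with u(1) show False by blast
  qed
  ultimately show "independent_family scale \<phi> A" by (simp add: independent_family_def)
qed

text \<open>A partition of the index set \<open>{1..M}\<close> into \<open>k\<close> labelled sets, some of which may be empty
  (unlike in \<open>partition_on\<close>).\<close>

definition index_partition :: "nat \<Rightarrow> nat \<Rightarrow> (nat \<Rightarrow> nat set) \<Rightarrow> bool" where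
  "index_partition M k A \<longleftrightarrow>
     (\<Union>i\<in>{1..k}. A i) = {1..M} \<and> disjoint_family_on A {1..k}"

end

theory Submission
  imports Defs
begin

text \<open>Take disjoint independent sets \<open>I i\<close> covering as many indices as possible. If \<open>x\<close> is uncovered,
  then \<open>\<phi> x\<close> lies in the span of every \<open>I i\<close>, and exchanging \<open>x\<close> for an element of its fundamental
  circuit in \<open>I i\<close> gives another maximum packing. Let \<open>R\<close> consist of all indices left uncovered by
  some packing reachable through such exchanges. An index uncovered by a reachable packing lies in
  the span of \<open>I i \<inter> R\<close>, because its whole circuit lies in \<open>R\<close>; and an exchange does not change that
  span. Hence the span of \<open>I i \<inter> R\<close> equals the span of \<open>R\<close> for every \<open>i\<close>, already for the initial
  packing, while \<open>R\<close> contains an index not covered by the initial packing.\<close>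

definition packing ::
    "('a::field \<Rightarrow> 'b::ab_group_add \<Rightarrow> 'b) \<Rightarrow> ('i \<Rightarrow> 'b) \<Rightarrow> 'i set \<Rightarrow> 'k set \<Rightarrow> ('k \<Rightarrow> 'i set) \<Rightarrow> bool"
  where
  "packing scale \<phi> E K I \<longleftrightarrow> disjoint_family_on I K \<and>
     (\<forall>i\<in>K. I i \<subseteq> E \<and> independent_family scale \<phi> (I i))"

text \<open>When \<open>E\<close> and \<open>K\<close> are finite, disjointness makes the sum the
  number of covered indices.\<close>

definition max_packing ::
    "('a::field \<Rightarrow> 'b::ab_group_add \<Rightarrow> 'b) \<Rightarrow> ('i \<Rightarrow> 'b) \<Rightarrow> 'i set \<Rightarrow> 'k set \<Rightarrow> ('k \<Rightarrow> 'i set) \<Rightarrow> bool"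
  where
  "max_packing scale \<phi> E K I \<longleftrightarrow> packing scale \<phi> E K I \<and>
     (\<forall>I'. packing scale \<phi> E K I' \<longrightarrow> (\<Sum>i\<in>K. card (I' i)) \<le> (\<Sum>i\<in>K. card (I i)))"

text \<open>If \<open>\<phi> x\<close> lies in the span of the independent set \<open>I i\<close>,
  the last premise says that \<open>y\<close> belongs to the fundamental circuit of \<open>x\<close>
  in \<open>I i\<close>. In this form it directly yields independence after the exchange.\<close>

inductive exchange_reachable ::
    "('a::field \<Rightarrow> 'b::ab_group_add \<Rightarrow> 'b) \<Rightarrow> ('i \<Rightarrow> 'b) \<Rightarrow> 'i set \<Rightarrow> 'k set \<Rightarrow>
      ('k \<Rightarrow> 'i set) \<Rightarrow> ('k \<Rightarrow> 'i set) \<Rightarrow> bool"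
  for scale \<phi> E K I\<^sub>0 where
  refl: "exchange_reachable scale \<phi> E K I\<^sub>0 I\<^sub>0"
| exchange: "exchange_reachable scale \<phi> E K I\<^sub>0 I \<Longrightarrow> i \<in> K \<Longrightarrow> x \<in> E - (\<Union>j\<in>K. I j) \<Longrightarrow> y \<in> I i \<Longrightarrow>
    \<phi> x \<notin> module.span scale (\<phi> ` (I i - {y})) \<Longrightarrow>
    exchange_reachable scale \<phi> E K I\<^sub>0 (I(i := insert x (I i - {y})))"

context vector_space
begin

section \<open>Independence, fundamental circuits and exchange for indexed vectors\<close>

lemma independent_family_mono:
  "independent_family scale \<phi> B \<Longrightarrow> A \<subseteq> B \<Longrightarrow> independent_family scale \<phi> A"
  unfolding independent_family_def by (meson image_mono independent_mono inj_on_subset)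

lemma independent_family_insert:
  assumes "independent_family scale \<phi> A" "\<phi> x \<notin> span (\<phi> ` A)"
  shows "independent_family scale \<phi> (insert x A)"
proof -
  have "\<phi> x \<notin> \<phi> ` A" using assms(2) span_base by blast
  with assms show ?thesis
    by (auto simp: independent_family_def independent_insert)
qed

lemma independent_family_not_in_span:
  assumes "independent_family scale \<phi> A" "y \<in> A"
  shows "\<phi> y \<notin> span (\<phi> ` (A - {y}))"
proof -
  have "\<phi> ` (A - {y}) = \<phi> ` A - {\<phi> y}"
    using assms by (auto simp: independent_family_def inj_on_def)
  then show ?thesis
    using assms by (auto simp: independent_family_def dependent_def)
qed

text \<open>An index with nonzero coefficient in the expansion of \<open>v\<close> cannot be
  dropped: otherwise solving for its vector would contradict independence. So the expansion only
  uses indices of the circuit.\<close>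

lemma in_span_fundamental_circuit:
  assumes "finite A" "independent_family scale \<phi> A" "v \<in> span (\<phi> ` A)"
  shows "v \<in> span (\<phi> ` {y \<in> A. v \<notin> span (\<phi> ` (A - {y}))})"
proof -
  from assms(1,3) obtain u where "v = (\<Sum>w\<in>\<phi> ` A. scale (u w) w)"
    by (auto simp: span_finite)
  \<comment> \<open>The coefficients belong to vectors; injectivity of \<open>\<phi>\<close> on
    \<open>A\<close> turns the sum into one over indices.\<close>
  then have v: "v = (\<Sum>y\<in>A. scale (u (\<phi> y)) (\<phi> y))"
    using assms(2) by (simp add: independent_family_def sum.reindex)
  have circuit: "v \<notin> span (\<phi> ` (A - {y}))" if y: "y \<in> A" "u (\<phi> y) \<noteq> 0" for y
  proof
    assume "v \<in> span (\<phi> ` (A - {y}))"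
    moreover have "(\<Sum>z\<in>A - {y}. scale (u (\<phi> z)) (\<phi> z)) \<in> span (\<phi> ` (A - {y}))"
      by (intro span_sum span_scale span_base) auto
    moreover have "v = scale (u (\<phi> y)) (\<phi> y) + (\<Sum>z\<in>A - {y}. scale (u (\<phi> z)) (\<phi> z))"
      by (subst v) (rule sum.remove[OF assms(1) y(1)])
    ultimately have "scale (u (\<phi> y)) (\<phi> y) \<in> span (\<phi> ` (A - {y}))"
      using span_add_eq2 by simp
    then have "scale (inverse (u (\<phi> y))) (scale (u (\<phi> y)) (\<phi> y)) \<in> span (\<phi> ` (A - {y}))"
      by (rule span_scale)
    with y(2) have "\<phi> y \<in> span (\<phi> ` (A - {y}))" by simp
    with independent_family_not_in_span[OF assms(2) y(1)] show False by blast
  qed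
  define C where "C = {y \<in> A. v \<notin> span (\<phi> ` (A - {y}))}"
  have "scale (u (\<phi> y)) (\<phi> y) \<in> span (\<phi> ` C)"
    if "y \<in> A" for y
  proof (cases "u (\<phi> y) = 0")
    case False
    then have "y \<in> C" using circuit[OF that] that by (simp add: C_def)
    then show ?thesis by (intro span_scale span_base imageI)
  qed (simp add: span_zero)
  then have "(\<Sum>y\<in>A. scale (u (\<phi> y)) (\<phi> y)) \<in> span (\<phi> ` C)" by (rule span_sum)
  with v show ?thesis by (simp only: C_def)
qed

text \<open>By Steinitz exchange, \<open>\<phi> y\<close> lies in the span of
  \<open>\<phi> x\<close> and the remaining vectors, so each family spans the other.\<close>

lemma span_exchange:
  assumes "\<phi> x \<in> span (\<phi> ` D)" "y \<in> D" "\<phi> x \<notin> span (\<phi> ` (D - {y}))"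
  shows "span (\<phi> ` insert x (D - {y})) = span (\<phi> ` D)"
proof -
  have D: "\<phi> ` D = insert (\<phi> y) (\<phi> ` (D - {y}))" using assms(2) by blast
  have "\<phi> y \<in> span (insert (\<phi> x) (\<phi> ` (D - {y})))"
    using assms(1,3) unfolding D by (rule in_span_insert)
  then have "\<phi> ` D \<subseteq> span (\<phi> ` insert x (D - {y}))"
    unfolding D by (auto intro: span_base)
  moreover have "\<phi> ` insert x (D - {y}) \<subseteq> span (\<phi> ` D)"
    using assms(1) by (auto intro: span_base)
  ultimately show ?thesis unfolding span_eq by simp
qed

section \<open>Packings of maximum total size\<close>

lemma sum_card_fun_upd:
  assumes "finite K" "i \<in> K"
  shows "(\<Sum>j\<in>K. card ((I(i := B)) j)) + card (I i) = (\<Sum>j\<in>K. card (I j)) + card B"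
proof -
  have "(\<Sum>j\<in>K - {i}. card ((I(i := B)) j)) = (\<Sum>j\<in>K - {i}. card (I j))"
    by (rule sum.cong) auto
  then show ?thesis
    using sum.remove[OF assms, of "\<lambda>j. card ((I(i := B)) j)"]
      sum.remove[OF assms, of "\<lambda>j. card (I j)"] by simp
qed

text \<open>As \<open>x\<close> is uncovered, adding it to one set creates no overlap. The general
  \<open>B\<close> serves both for adding \<open>x\<close> and for exchanging it with some
  \<open>y\<close>.\<close>

lemma packing_fun_upd:
  assumes "packing scale \<phi> E K I" "i \<in> K" "x \<in> E - (\<Union>j\<in>K. I j)"
    and "B \<subseteq> insert x (I i)" "independent_family scale \<phi> B"
  shows "packing scale \<phi> E K (I(i := B))"
  unfolding packing_def
proof (intro conjI ballI)
  have "I j \<inter> insert x (I i) = {}" if "j \<in> K" "j \<noteq> i" for j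
    using that assms(1-3) by (auto simp: packing_def disjoint_family_on_def)
  with assms(4) have "I j \<inter> B = {}" if "j \<in> K" "j \<noteq> i" for j
    using that by blast
  then show "disjoint_family_on (I(i := B)) K"
    using assms(1) by (simp add: packing_def disjoint_family_on_def Int_commute)
qed (use assms in \<open>auto simp: packing_def split: if_splits\<close>)

lemma packing_finite:
  "packing scale \<phi> E K I \<Longrightarrow> finite E \<Longrightarrow> i \<in> K \<Longrightarrow> finite (I i)"
  unfolding packing_def by (meson finite_subset)

lemma ex_max_packing:
  assumes "finite E" "finite K"
  shows "\<exists>I. max_packing scale \<phi> E K I"
proof -
  have "packing scale \<phi> E K (\<lambda>_. {})"
    by (simp add: packing_def disjoint_family_on_def independent_family_def independent_empty)
  moreover have "(\<Sum>i\<in>K. card (I i)) < Suc (card E)" if "packing scale \<phi> E K I" for I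
  proof -
    have "\<forall>i\<in>K. finite (I i)"
      using packing_finite[OF that assms(1)] by blast
    then have "(\<Sum>i\<in>K. card (I i)) = card (\<Union>i\<in>K. I i)"
      using that assms(2) unfolding packing_def disjoint_family_on_def
      by (intro card_UN_disjoint[symmetric]) auto
    also have "\<dots> \<le> card E"
      using that by (intro card_mono assms) (auto simp: packing_def)
    finally show ?thesis by simp
  qed
  ultimately show ?thesis
    using ex_has_greatest_nat[of "packing scale \<phi> E K" "\<lambda>_. {}" "\<lambda>I. \<Sum>i\<in>K. card (I i)"]
    unfolding max_packing_def by metis
qed

text \<open>Otherwise \<open>x\<close> could be added to \<open>I i\<close>, giving a packing with a
  larger total.\<close>

lemma max_packing_in_span:
  assumes "finite E" "finite K" "max_packing scale \<phi> E K I" "i \<in> K" "x \<in> E - (\<Union>j\<in>K. I j)"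
  shows "\<phi> x \<in> span (\<phi> ` I i)"
proof (rule ccontr)
  assume notin: "\<phi> x \<notin> span (\<phi> ` I i)"
  have p: "packing scale \<phi> E K I" using assms(3) by (simp add: max_packing_def)
  then have "independent_family scale \<phi> (insert x (I i))"
    using assms(4) notin by (intro independent_family_insert) (auto simp: packing_def)
  then have "packing scale \<phi> E K (I(i := insert x (I i)))"
    by (intro packing_fun_upd[OF p assms(4,5)]) auto
  then have "(\<Sum>j\<in>K. card ((I(i := insert x (I i))) j)) \<le> (\<Sum>j\<in>K. card (I j))"
    using assms(3) by (simp only: max_packing_def)
  moreover have "finite (I i)" "x \<notin> I i"
    using packing_finite[OF p assms(1,4)] assms(4,5) by auto
  ultimately show False
    using sum_card_fun_upd[OF assms(2,4), of I "insert x (I i)"] by simp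
qed

text \<open>One index enters \<open>I i\<close> and one leaves, so the total stays maximal; the
  condition on \<open>y\<close> preserves independence.\<close>

lemma max_packing_exchange:
  assumes "finite E" "finite K" "max_packing scale \<phi> E K I" "i \<in> K" "x \<in> E - (\<Union>j\<in>K. I j)"
    and "y \<in> I i" "\<phi> x \<notin> span (\<phi> ` (I i - {y}))"
  shows "max_packing scale \<phi> E K (I(i := insert x (I i - {y})))"
proof -
  have p: "packing scale \<phi> E K I" using assms(3) by (simp add: max_packing_def)
  have "independent_family scale \<phi> (I i - {y})"
    using p assms(4) by (auto simp: packing_def intro: independent_family_mono[of \<phi> "I i"])
  then have "independent_family scale \<phi> (insert x (I i - {y}))"
    using assms(7) by (rule independent_family_insert)
  then have "packing scale \<phi> E K (I(i := insert x (I i - {y})))"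
    by (intro packing_fun_upd[OF p assms(4,5)]) auto
  moreover have "finite (I i)" "x \<notin> I i"
    using packing_finite[OF p assms(1,4)] assms(4,5) by auto
  then have "card (insert x (I i - {y})) = card (I i)"
    using assms(6) by (simp add: card_Suc_Diff1 del: card_Diff_singleton card_Diff_insert)
  ultimately show ?thesis
    using assms(3) sum_card_fun_upd[OF assms(2,4), of I "insert x (I i - {y})"]
    unfolding max_packing_def by (simp only: add_right_cancel) blast
qed

section \<open>Closure under exchanges and counting in its span\<close>

lemma max_packing_exchange_reachable:
  assumes "exchange_reachable scale \<phi> E K I\<^sub>0 I" "finite E" "finite K" "max_packing scale \<phi> E K I\<^sub>0"
  shows "max_packing scale \<phi> E K I"
  using assms by (induction rule: exchange_reachable.induct) (auto intro: max_packing_exchange)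

lemma max_packing_span_core:
  assumes fin: "finite E" "finite K" and max: "max_packing scale \<phi> E K I\<^sub>0"
  obtains R where "E - (\<Union>i\<in>K. I\<^sub>0 i) \<subseteq> R" "R \<subseteq> E"
    "\<And>i. i \<in> K \<Longrightarrow> span (\<phi> ` (I\<^sub>0 i \<inter> R)) = span (\<phi> ` R)"
proof -
  define R where "R = {x \<in> E. \<exists>I. exchange_reachable scale \<phi> E K I\<^sub>0 I \<and> x \<notin> (\<Union>i\<in>K. I i)}"
  have in_R: "x \<in> R" if "exchange_reachable scale \<phi> E K I\<^sub>0 I" "x \<in> E - (\<Union>i\<in>K. I i)" for x I
    using that by (auto simp: R_def)
  \<comment> \<open>After the exchange \<open>y\<close> is uncovered: it differs from
    \<open>x\<close>, and disjointness keeps it out of the other sets.\<close>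
  have circuit_in_R: "y \<in> R"
    if I: "exchange_reachable scale \<phi> E K I\<^sub>0 I" and i: "i \<in> K" and x: "x \<in> E - (\<Union>j\<in>K. I j)"
      and y: "y \<in> I i" "\<phi> x \<notin> span (\<phi> ` (I i - {y}))" for I i x y
  proof (rule in_R[OF exchange_reachable.exchange[OF I i x y]])
    have "packing scale \<phi> E K I"
      using max_packing_exchange_reachable[OF I fin max] by (simp add: max_packing_def)
    then show "y \<in> E - (\<Union>j\<in>K. (I(i := insert x (I i - {y}))) j)"
      using i x y(1) by (auto simp: packing_def disjoint_family_on_def split: if_splits)
  qed
  have span_R: "\<phi> x \<in> span (\<phi> ` (I i \<inter> R))"
    if I: "exchange_reachable scale \<phi> E K I\<^sub>0 I" and i: "i \<in> K" and x: "x \<in> E - (\<Union>j\<in>K. I j)" for I i x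
  proof -
    have m: "max_packing scale \<phi> E K I"
      using max_packing_exchange_reachable[OF I fin max] .
    then have "independent_family scale \<phi> (I i)" "finite (I i)"
      using i packing_finite[OF _ fin(1) i, of \<phi> I] by (auto simp: max_packing_def packing_def)
    then have "\<phi> x \<in> span (\<phi> ` {y \<in> I i. \<phi> x \<notin> span (\<phi> ` (I i - {y}))})"
      using in_span_fundamental_circuit max_packing_in_span[OF fin m i x] by blast
    also have "\<dots> \<subseteq> span (\<phi> ` (I i \<inter> R))"
      using circuit_in_R[OF I i x] by (intro span_mono) auto
    finally show ?thesis .
  qed
  \<comment> \<open>An exchange in \<open>I j\<close> takes place entirely inside \<open>R\<close>:
    \<open>x\<close> is uncovered before it and \<open>y\<close> after it. Thus
    \<open>I j \<inter> R\<close> undergoes the same exchange, and \<open>span_R\<close> allows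
    \<open>span_exchange\<close> to be applied to it.\<close>
  have invariant: "span (\<phi> ` (I i \<inter> R)) = span (\<phi> ` (I\<^sub>0 i \<inter> R))"
    if "exchange_reachable scale \<phi> E K I\<^sub>0 I" "i \<in> K" for I i
    using that
  proof (induction rule: exchange_reachable.induct)
    case (exchange I j x y)
    show ?case
    proof (cases "i = j")
      case True
      have R: "x \<in> R" "y \<in> R"
        using in_R[OF exchange.hyps(1,3)] circuit_in_R[OF exchange.hyps] by auto
      have "\<phi> x \<notin> span (\<phi> ` (I j \<inter> R - {y}))"
        using exchange.hyps(5) span_mono[of "\<phi> ` (I j \<inter> R - {y})" "\<phi> ` (I j - {y})"] by blast
      then have "span (\<phi> ` insert x (I j \<inter> R - {y})) = span (\<phi> ` (I j \<inter> R))"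
        using exchange.hyps R by (intro span_exchange span_R) auto
      moreover have "insert x (I j - {y}) \<inter> R = insert x (I j \<inter> R - {y})"
        using R by blast
      ultimately show ?thesis using True exchange by simp
    qed (use exchange in simp)
  qed simp
  show ?thesis
  proof (rule that[of R])
    show "R \<subseteq> E" by (auto simp: R_def)
    show "E - (\<Union>i\<in>K. I\<^sub>0 i) \<subseteq> R" using in_R[OF exchange_reachable.refl] by blast
    show "span (\<phi> ` (I\<^sub>0 i \<inter> R)) = span (\<phi> ` R)" if i: "i \<in> K" for i
    proof
      show "span (\<phi> ` (I\<^sub>0 i \<inter> R)) \<subseteq> span (\<phi> ` R)" by (intro span_mono) auto
      \<comment> \<open>The packing missing \<open>x\<close> depends on \<open>x\<close>; the
        invariant carries the span membership back to the common starting packing.\<close>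
      have "\<phi> x \<in> span (\<phi> ` (I\<^sub>0 i \<inter> R))" if "x \<in> R" for x
      proof -
        from that obtain I where I: "exchange_reachable scale \<phi> E K I\<^sub>0 I" "x \<in> E - (\<Union>i\<in>K. I i)"
          by (auto simp: R_def)
        show ?thesis using span_R[OF I(1) i I(2)] invariant[OF I(1) i] by simp
      qed
      then show "span (\<phi> ` R) \<subseteq> span (\<phi> ` (I\<^sub>0 i \<inter> R))"
        by (intro span_minimal subspace_span) auto
    qed
  qed
qed

lemma card_gt_if_packing_span_core:
  assumes fin: "finite J" "finite K" and p: "packing scale \<phi> E K I"
    and "R \<subseteq> J" "x \<in> R" "x \<notin> (\<Union>i\<in>K. I i)"
    and span: "\<And>i. i \<in> K \<Longrightarrow> span (\<phi> ` (I i \<inter> R)) = span (\<phi> ` R)"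
  shows "card K * dim (\<phi> ` R) < card J"
proof -
  have "dim (\<phi> ` R) = card (I i \<inter> R)" if i: "i \<in> K" for i
  proof -
    have ind: "independent_family scale \<phi> (I i \<inter> R)"
      using p i by (auto simp: packing_def intro: independent_family_mono[of \<phi> "I i"])
    have "dim (\<phi> ` R) = dim (\<phi> ` (I i \<inter> R))" using span[OF i] by (metis dim_span)
    also have "\<dots> = card (I i \<inter> R)"
      using ind by (simp add: independent_family_def dim_eq_card_independent card_image)
    finally show ?thesis .
  qed
  then have "(\<Sum>i\<in>K. card (I i \<inter> R)) = (\<Sum>i\<in>K. dim (\<phi> ` R))" by (intro sum.cong) auto
  then have "card K * dim (\<phi> ` R) = (\<Sum>i\<in>K. card (I i \<inter> R))" by simp
  also have "\<dots> = card (\<Union>i\<in>K. I i \<inter> R)"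
  proof (intro card_UN_disjoint[symmetric] ballI impI)
    show "finite (I i \<inter> R)" for i using \<open>R \<subseteq> J\<close> fin(1) by (meson finite_Int finite_subset)
    show "I i \<inter> R \<inter> (I j \<inter> R) = {}" if "i \<in> K" "j \<in> K" "i \<noteq> j" for i j
      using p that unfolding packing_def disjoint_family_on_def by blast
  qed (rule fin)
  also have "\<dots> < card J"
    using assms by (intro psubset_card_mono) auto
  finally show ?thesis .
qed

section \<open>From a maximum packing to the partition and the subspace\<close>

lemma index_partition_span_core:
  assumes "k \<ge> 1"
    and no_partition: "\<not> (\<exists>B. index_partition M k B \<and>
      (\<forall>i\<in>{1..k}. independent_family scale \<phi> (B i)))"
  shows "\<exists>A S. index_partition M k A \<and> subspace S \<and>
    (\<forall>i\<in>{1..k}. \<exists>T. T \<subseteq> A i \<and> S = span (\<phi> ` T)) \<and>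
    (let J = {i\<in>{1..M}. \<phi> i \<in> S} in card J > k * dim (span (\<phi> ` J)))"
proof -
  obtain I where max: "max_packing scale \<phi> {1..M} {1..k} I"
    using ex_max_packing[of "{1..M}" "{1..k}" \<phi>] by auto
  then have p: "packing scale \<phi> {1..M} {1..k} I" by (simp add: max_packing_def)
  let ?U = "{1..M} - (\<Union>i\<in>{1..k}. I i)"
  obtain R where R: "?U \<subseteq> R" "R \<subseteq> {1..M}"
    "\<And>i. i \<in> {1..k} \<Longrightarrow> span (\<phi> ` (I i \<inter> R)) = span (\<phi> ` R)"
    using max_packing_span_core[OF _ _ max] by auto
  \<comment> \<open>A packing covering every index would be one of the excluded partitions.\<close>
  have "?U \<noteq> {}"
  proof
    assume "?U = {}"
    with p have "index_partition M k I \<and> (\<forall>i\<in>{1..k}. independent_family scale \<phi> (I i))"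
      by (auto simp: index_partition_def packing_def)
    with no_partition show False by blast
  qed
  then obtain x where x: "x \<in> ?U" by blast
  \<comment> \<open>All uncovered indices go into the first class, which exists because
    \<open>k \<ge> 1\<close>. Independence of that class may be lost, but the spanning subsets
    \<open>I i \<inter> R\<close> survive.\<close>
  define A where "A = I(1 := I 1 \<union> ?U)"
  have A: "index_partition M k A"
    unfolding index_partition_def
  proof
    show "(\<Union>i\<in>{1..k}. A i) = {1..M}"
    proof
      show "(\<Union>i\<in>{1..k}. A i) \<subseteq> {1..M}"
        using p \<open>k \<ge> 1\<close> by (fastforce simp: A_def packing_def split: if_splits)
      show "{1..M} \<subseteq> (\<Union>i\<in>{1..k}. A i)"
        using \<open>k \<ge> 1\<close> by (force simp: A_def)
    qed
    show "disjoint_family_on A {1..k}"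
      using p by (fastforce simp: A_def packing_def disjoint_family_on_def)
  qed
  have span_A: "\<exists>T. T \<subseteq> A i \<and> span (\<phi> ` R) = span (\<phi> ` T)" if "i \<in> {1..k}" for i
    using R(3)[OF that] by (intro exI[of _ "I i \<inter> R"]) (auto simp: A_def)
  define J where "J = {i\<in>{1..M}. \<phi> i \<in> span (\<phi> ` R)}"
  have RJ: "R \<subseteq> J" using R(2) by (auto simp: J_def intro: span_base)
  \<comment> \<open>Passing from \<open>R\<close> to \<open>J\<close> only adds indices whose
    vectors already lie in the span of \<open>R\<close>, so the dimension is unchanged.\<close>
  have "span (\<phi> ` J) = span (\<phi> ` R)"
    unfolding span_eq using RJ by (auto simp: J_def intro: span_base)
  moreover have "card {1..k} * dim (\<phi> ` R) < card J"
  proof (rule card_gt_if_packing_span_core[OF _ _ p RJ])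
    show "x \<in> R" "x \<notin> (\<Union>i\<in>{1..k}. I i)" using x R(1) by blast+
  qed (use R(3) in \<open>auto simp: J_def\<close>)
  ultimately have "k * dim (span (\<phi> ` J)) < card J" by simp
  then show ?thesis
    using A span_A subspace_span unfolding J_def Let_def
    by (intro exI[of _ A] exI[of _ "span (\<phi> ` R)"] conjI ballI)
qed

end

theorem theorem3p3:
  fixes scale :: "'a::field \<Rightarrow> 'b::ab_group_add \<Rightarrow> 'b"
    and \<phi> :: "nat \<Rightarrow> 'b"
    and M k :: nat
  assumes "vector_space scale"
    and "k \<ge> 1"
    and "\<not> (\<exists>B. index_partition M k B \<and>
               (\<forall>i\<in>{1..k}. independent_family scale \<phi> (B i)))"
  shows "\<exists>A S. index_partition M k A \<and> module.subspace scale S \<and>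
           (\<forall>i\<in>{1..k}. \<exists>T. T \<subseteq> A i \<and> S = module.span scale (\<phi> ` T)) \<and>
           (let J = {i\<in>{1..M}. \<phi> i \<in> S}
            in card J > k * vector_space.dim scale (module.span scale (\<phi> ` J)))"
  using assms by (rule vector_space.index_partition_span_core)

end
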